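(* Suppose that $S$ and $T$ are strongly Morita equivalent inverse semigroups. Then $S$ is $F$-inverse if and only if $T$ is $F$-inverse.
   Context: An inverse semigroup is a semigroup $S$ such that for each $s\in S$ there is a unique $s^*\in S$ with $ss^*s=s$ and $s^*ss^*=s^*$; $E(S)$ is its set of idempotents; $s\le t$ means $s=et$ for some $e\in E(S)$. The maximal group image $\sigma\colon S\to G(S)$ is the quotient of $S$ by the congruence identifying two elements iff they have a common lower bound in $\le$. $S$ is called $F$-inverse if $\sigma^{-1}(g)\cap eSf$ has a maximum element (with respect to $\le$) for all $g\in G(S)$ and $e,f\in E(S)$. A Morita context is a 5-tuple $(S,T,X,\langle\ ,\ \rangle,[\ ,\ ])$ where $S,T$ are inverse semigroups, $X$ is a set with a left action of $S$ and a right action of $T$ that commute, and $\langle\ ,\ \rangle\colon X\times X\to S$, $[\ ,\ ]\colon X\times X\to T$ are surjective functions such that for all $x,y,z\in X$, $s\in S$, $t\in T$: (1) $\langle sx,y\rangle=s\langle x,y\rangle$; (2) $\langle y,x\rangle=\langle x,y\rangle^*$; (3) $\langle x,x\rangle x=x$; (4) $[x,yt]=[x,y]t$; (5) $[y,x]=[x,y]^*$; (6) $x[x,x]=x$; (7) $\langle x,y\rangle z=x[y,z]$. $S$ and $T$ are strongly Morita equivalent if such a Morita context exists. *)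

theory Defs
  imports Main
begin

locale inverse_semigroup =
  fixes S :: "'a set" and mult :: "'a \<Rightarrow> 'a \<Rightarrow> 'a" (infixl "\<cdot>" 70)
  assumes mult_closed: "s \<in> S \<Longrightarrow> t \<in> S \<Longrightarrow> s \<cdot> t \<in> S"
    and mult_assoc: "s \<in> S \<Longrightarrow> t \<in> S \<Longrightarrow> u \<in> S \<Longrightarrow> (s \<cdot> t) \<cdot> u = s \<cdot> (t \<cdot> u)"
    and unique_inverse: "s \<in> S \<Longrightarrow> \<exists>!s'. s' \<in> S \<and> s \<cdot> s' \<cdot> s = s \<and> s' \<cdot> s \<cdot> s' = s'"
begin

definition star :: "'a \<Rightarrow> 'a" where
  "star s = (THE s'. s' \<in> S \<and> s \<cdot> s' \<cdot> s = s \<and> s' \<cdot> s \<cdot> s' = s')"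

definition idempotents :: "'a set" where
  "idempotents = {e \<in> S. e \<cdot> e = e}"

definition nat_le :: "'a \<Rightarrow> 'a \<Rightarrow> bool" where
  "nat_le s t \<longleftrightarrow> (\<exists>e \<in> idempotents. s = e \<cdot> t)"

definition sigma_cong :: "('a \<times> 'a) set" where
  "sigma_cong = {(s, t). s \<in> S \<and> t \<in> S \<and> (\<exists>u \<in> S. nat_le u s \<and> nat_le u t)}"

text \<open>The underlying set of the maximal group image and the quotient map onto it;
  the group multiplication plays no role in being $F$-inverse.\<close>

definition max_group_image :: "'a set set" where
  "max_group_image = S // sigma_cong"

definition sigma :: "'a \<Rightarrow> 'a set" where
  "sigma s = sigma_cong `` {s}"

definition local_set :: "'a \<Rightarrow> 'a \<Rightarrow> 'a set" where
  "local_set e f = {e \<cdot> s \<cdot> f | s. s \<in> S}"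

definition F_inverse :: bool where
  "F_inverse \<longleftrightarrow>
    (\<forall>g \<in> max_group_image. \<forall>e \<in> idempotents. \<forall>f \<in> idempotents.
      \<exists>m \<in> {s \<in> S. sigma s = g} \<inter> local_set e f.
        \<forall>s \<in> {s \<in> S. sigma s = g} \<inter> local_set e f. nat_le s m)"

end

locale Morita_context =
  S: inverse_semigroup S multS + T: inverse_semigroup T multT
  for S :: "'a set" and multS :: "'a \<Rightarrow> 'a \<Rightarrow> 'a" (infixl "\<cdot>\<^sub>S" 70)
    and T :: "'b set" and multT :: "'b \<Rightarrow> 'b \<Rightarrow> 'b" (infixl "\<cdot>\<^sub>T" 70) +
  fixes X :: "'x set"
    and lact :: "'a \<Rightarrow> 'x \<Rightarrow> 'x" (infixr "\<rhd>" 75)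
    and ract :: "'x \<Rightarrow> 'b \<Rightarrow> 'x" (infixl "\<lhd>" 75)
    and ipS :: "'x \<Rightarrow> 'x \<Rightarrow> 'a"
    and ipT :: "'x \<Rightarrow> 'x \<Rightarrow> 'b"
  assumes lact_closed: "s \<in> S \<Longrightarrow> x \<in> X \<Longrightarrow> s \<rhd> x \<in> X"
    and lact_assoc: "s \<in> S \<Longrightarrow> s' \<in> S \<Longrightarrow> x \<in> X \<Longrightarrow> (s \<cdot>\<^sub>S s') \<rhd> x = s \<rhd> (s' \<rhd> x)"
    and ract_closed: "x \<in> X \<Longrightarrow> t \<in> T \<Longrightarrow> x \<lhd> t \<in> X"
    and ract_assoc: "x \<in> X \<Longrightarrow> t \<in> T \<Longrightarrow> t' \<in> T \<Longrightarrow> x \<lhd> (t \<cdot>\<^sub>T t') = (x \<lhd> t) \<lhd> t'"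
    and act_commute: "s \<in> S \<Longrightarrow> x \<in> X \<Longrightarrow> t \<in> T \<Longrightarrow> (s \<rhd> x) \<lhd> t = s \<rhd> (x \<lhd> t)"
    and ipS_surj: "(\<lambda>(x, y). ipS x y) ` (X \<times> X) = S"
    and ipT_surj: "(\<lambda>(x, y). ipT x y) ` (X \<times> X) = T"
    and ipS_lact: "s \<in> S \<Longrightarrow> x \<in> X \<Longrightarrow> y \<in> X \<Longrightarrow> ipS (s \<rhd> x) y = s \<cdot>\<^sub>S ipS x y"
    and ipS_star: "x \<in> X \<Longrightarrow> y \<in> X \<Longrightarrow> ipS y x = S.star (ipS x y)"
    and ipS_self: "x \<in> X \<Longrightarrow> ipS x x \<rhd> x = x"
    and ipT_ract: "x \<in> X \<Longrightarrow> y \<in> X \<Longrightarrow> t \<in> T \<Longrightarrow> ipT x (y \<lhd> t) = ipT x y \<cdot>\<^sub>T t"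
    and ipT_star: "x \<in> X \<Longrightarrow> y \<in> X \<Longrightarrow> ipT y x = T.star (ipT x y)"
    and ipT_self: "x \<in> X \<Longrightarrow> x \<lhd> ipT x x = x"
    and ip_compat: "x \<in> X \<Longrightarrow> y \<in> X \<Longrightarrow> z \<in> X \<Longrightarrow> ipS x y \<rhd> z = x \<lhd> ipT y z"

text \<open>HOL cannot quantify existentially over types, so the type in which the set
  \<open>X\<close> of the Morita context lives is a parameter. A theorem assuming this
  notion for a free type variable covers Morita contexts over arbitrary types.\<close>

definition strongly_Morita_equivalent ::
  "'x itself \<Rightarrow> 'a set \<Rightarrow> ('a \<Rightarrow> 'a \<Rightarrow> 'a) \<Rightarrow> 'b set \<Rightarrow> ('b \<Rightarrow> 'b \<Rightarrow> 'b) \<Rightarrow> bool" where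
  "strongly_Morita_equivalent _ S multS T multT \<longleftrightarrow>
    (\<exists>(X :: 'x set) lact ract ipS ipT. Morita_context S multS T multT X lact ract ipS ipT)"

end

theory Submission
  imports Defs
begin

text \<open>Every idempotent of \<open>T\<close> has the form \<open>[x, x]\<close>. For \<open>e = [x, x]\<close> and \<open>f = [y, y]\<close> the maps
  \<open>t \<mapsto> \<langle>x t, y\<rangle>\<close> and \<open>s \<mapsto> [x, s y]\<close> are mutually inverse order isomorphisms between \<open>e T f\<close> and
  \<open>\<langle>x, x\<rangle> S \<langle>y, y\<rangle>\<close>. Local sets are closed downwards, so these maps also respect the relation of having
  a common lower bound, and they carry maxima to maxima. The converse implication is obtained from the
  same argument applied to the dual Morita context, in which the actions are twisted by the
  involutions.\<close>

section \<open>Inverse semigroups\<close>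

context inverse_semigroup
begin

section \<open>Inverses and the semilattice of idempotents\<close>

lemma star_props:
  assumes "s \<in> S"
  shows star_closed: "star s \<in> S"
    and mult_star_mult: "s \<cdot> star s \<cdot> s = s"
    and star_mult_star: "star s \<cdot> s \<cdot> star s = star s"
  using theI'[OF unique_inverse[OF assms]] unfolding star_def by blast+

lemma star_eqI:
  assumes "s \<in> S" "s' \<in> S" "s \<cdot> s' \<cdot> s = s" "s' \<cdot> s \<cdot> s' = s'"
  shows "star s = s'"
  using unique_inverse[OF assms(1)] star_props[OF assms(1)] assms by blast

lemmas closed = mult_closed star_closed

lemma star_star: "s \<in> S \<Longrightarrow> star (star s) = s"
  by (simp add: star_eqI star_props)

lemma idempotents_closed: "e \<in> idempotents \<Longrightarrow> e \<in> S"
  by (simp add: idempotents_def)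

lemma idempotent_mult_self: "e \<in> idempotents \<Longrightarrow> e \<cdot> e = e"
  by (simp add: idempotents_def)

lemma idempotent_mult_self_left: "e \<in> idempotents \<Longrightarrow> s \<in> S \<Longrightarrow> e \<cdot> (e \<cdot> s) = e \<cdot> s"
  by (metis idempotent_mult_self idempotents_closed mult_assoc)

lemma star_idempotent: "e \<in> idempotents \<Longrightarrow> star e = e"
  by (simp add: idempotent_mult_self idempotents_closed star_eqI)

lemma idempotents_mult_closed:
  assumes e: "e \<in> idempotents" and f: "f \<in> idempotents"
  shows "e \<cdot> f \<in> idempotents"
proof -
  note [simp] = mult_assoc closed idempotents_closed[OF e] idempotents_closed[OF f]
    idempotent_mult_self[OF e] idempotent_mult_self[OF f]
    idempotent_mult_self_left[OF e] idempotent_mult_self_left[OF f]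
  define x where "x = star (e \<cdot> f)"
  have x[simp]: "x \<in> S" by (simp add: x_def)
  have 1: "e \<cdot> (f \<cdot> (x \<cdot> (e \<cdot> f))) = e \<cdot> f"
    using mult_star_mult[of "e \<cdot> f"] by (simp flip: x_def)
  have 2: "x \<cdot> (e \<cdot> (f \<cdot> x)) = x"
    using star_mult_star[of "e \<cdot> f"] by (simp flip: x_def)
  have 3: "x \<cdot> (e \<cdot> (f \<cdot> (x \<cdot> e))) = x \<cdot> e"
    using arg_cong[OF 2, of "\<lambda>z. z \<cdot> e"] by simp
  \<comment> \<open>\<open>f x e\<close> is again an inverse of \<open>e f\<close>, so it equals \<open>x\<close>, which makes \<open>x\<close> idempotent.\<close>
  have 4: "x = f \<cdot> (x \<cdot> e)"
    unfolding x_def by (rule star_eqI) (simp_all add: 1 3 flip: x_def)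
  have "x \<cdot> x = (f \<cdot> (x \<cdot> e)) \<cdot> (f \<cdot> (x \<cdot> e))" by (simp only: flip: 4)
  also have "\<dots> = f \<cdot> (x \<cdot> (e \<cdot> (f \<cdot> (x \<cdot> e))))" by simp
  also have "\<dots> = x" unfolding 3 by (rule 4[symmetric])
  finally have "x \<in> idempotents" by (simp add: idempotents_def)
  moreover have "star x = e \<cdot> f" by (simp add: x_def star_star)
  ultimately show ?thesis by (simp add: star_idempotent)
qed

text \<open>Both products are idempotent, so \<open>f \<cdot> e\<close> satisfies the two equations
  of an inverse of \<open>e \<cdot> f\<close>. An idempotent is its own inverse, and uniqueness does
  the rest.\<close>

lemma idempotents_commute:
  assumes e: "e \<in> idempotents" and f: "f \<in> idempotents"
  shows "e \<cdot> f = f \<cdot> e"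
proof -
  note [simp] = mult_assoc closed idempotents_closed[OF e] idempotents_closed[OF f]
    idempotent_mult_self_left[OF e] idempotent_mult_self_left[OF f]
  have "star (e \<cdot> f) = f \<cdot> e"
    using idempotent_mult_self[OF idempotents_mult_closed[OF e f]]
      idempotent_mult_self[OF idempotents_mult_closed[OF f e]]
    by (intro star_eqI) simp_all
  then show ?thesis using star_idempotent[OF idempotents_mult_closed[OF e f]] by simp
qed

lemma star_mult_idempotent: "s \<in> S \<Longrightarrow> star s \<cdot> s \<in> idempotents"
  and mult_star_idempotent: "s \<in> S \<Longrightarrow> s \<cdot> star s \<in> idempotents"
  by (auto simp: idempotents_def closed star_mult_star mult_star_mult simp flip: mult_assoc)

text \<open>Commuting \<open>e\<close> past the idempotent \<open>star s \<cdot> s\<close> gives the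
  second equation, and the first claim follows from it. The order \<open>nat_le\<close> multiplies
  on the left only; this lemma carries a right factor over to that side.\<close>

lemma conj_idempotent:
  assumes s: "s \<in> S" and e: "e \<in> idempotents"
  shows "s \<cdot> e \<cdot> star s \<in> idempotents" and "s \<cdot> e \<cdot> star s \<cdot> s = s \<cdot> e"
proof -
  note [simp] = closed idempotents_closed[OF e] s
  have "s \<cdot> e \<cdot> star s \<cdot> s = s \<cdot> (e \<cdot> (star s \<cdot> s))" by (simp add: mult_assoc)
  also have "\<dots> = s \<cdot> ((star s \<cdot> s) \<cdot> e)"
    by (simp only: idempotents_commute[OF e star_mult_idempotent[OF s]])
  also have "\<dots> = (s \<cdot> star s \<cdot> s) \<cdot> e" by (simp add: mult_assoc)
  finally show *: "s \<cdot> e \<cdot> star s \<cdot> s = s \<cdot> e" by (simp add: mult_star_mult)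
  have "(s \<cdot> e \<cdot> star s) \<cdot> (s \<cdot> e \<cdot> star s) = (s \<cdot> e \<cdot> star s \<cdot> s) \<cdot> (e \<cdot> star s)"
    by (simp add: mult_assoc)
  also have "\<dots> = s \<cdot> e \<cdot> star s"
    by (subst *) (simp add: mult_assoc idempotent_mult_self_left[OF e])
  finally show "s \<cdot> e \<cdot> star s \<in> idempotents" by (simp add: idempotents_def)
qed

text \<open>Swapping the adjacent idempotents \<open>t \<cdot> star t\<close> and
  \<open>star s \<cdot> s\<close> regroups each product into a factor in \<open>s\<close> and a
  factor in \<open>t\<close>, which collapse separately.\<close>

lemma star_mult:
  assumes s: "s \<in> S" and t: "t \<in> S"
  shows "star (s \<cdot> t) = star t \<cdot> star s"
proof (rule star_eqI)
  note [simp] = closed s t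
  have comm: "(t \<cdot> star t) \<cdot> (star s \<cdot> s) = (star s \<cdot> s) \<cdot> (t \<cdot> star t)"
    by (rule idempotents_commute[OF mult_star_idempotent[OF t] star_mult_idempotent[OF s]])
  have "s \<cdot> t \<cdot> (star t \<cdot> star s) \<cdot> (s \<cdot> t) = s \<cdot> ((t \<cdot> star t) \<cdot> (star s \<cdot> s)) \<cdot> t"
    by (simp add: mult_assoc)
  also have "\<dots> = (s \<cdot> star s \<cdot> s) \<cdot> (t \<cdot> star t \<cdot> t)"
    by (subst comm) (simp add: mult_assoc)
  finally show "s \<cdot> t \<cdot> (star t \<cdot> star s) \<cdot> (s \<cdot> t) = s \<cdot> t"
    by (simp add: mult_star_mult)
  have "star t \<cdot> star s \<cdot> (s \<cdot> t) \<cdot> (star t \<cdot> star s)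
      = star t \<cdot> ((star s \<cdot> s) \<cdot> (t \<cdot> star t)) \<cdot> star s"
    by (simp add: mult_assoc)
  also have "\<dots> = (star t \<cdot> t \<cdot> star t) \<cdot> (star s \<cdot> s \<cdot> star s)"
    by (subst comm[symmetric]) (simp add: mult_assoc)
  finally show "star t \<cdot> star s \<cdot> (s \<cdot> t) \<cdot> (star t \<cdot> star s) = star t \<cdot> star s"
    by (simp add: star_mult_star)
qed (simp_all add: closed s t)

section \<open>Natural order and the congruence of the maximal group image\<close>

lemma nat_leI: "e \<in> idempotents \<Longrightarrow> nat_le (e \<cdot> t) t"
  by (auto simp: nat_le_def)

lemma nat_le_refl: "s \<in> S \<Longrightarrow> nat_le s s"
  using nat_leI[OF mult_star_idempotent, of s s] by (simp add: mult_star_mult)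

lemma nat_le_trans:
  assumes "nat_le s t" "nat_le t u" "u \<in> S"
  shows "nat_le s u"
proof -
  obtain e f where ef: "e \<in> idempotents" "f \<in> idempotents" and eq: "s = e \<cdot> t" "t = f \<cdot> u"
    using assms by (auto simp: nat_le_def)
  have "s = (e \<cdot> f) \<cdot> u" using ef eq assms by (simp add: mult_assoc idempotents_closed)
  then show ?thesis using nat_leI[OF idempotents_mult_closed[OF ef]] by simp
qed

lemma equiv_sigma_cong: "equiv S sigma_cong"
proof (rule equivI)
  show "sigma_cong \<subseteq> S \<times> S" by (auto simp: sigma_cong_def)
  show "refl_on S sigma_cong"
    using nat_le_refl by (auto simp: refl_on_def sigma_cong_def)
  show "sym sigma_cong" by (auto simp: sym_def sigma_cong_def)
  show "trans sigma_cong"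
  proof (rule transI)
    fix s t w assume "(s, t) \<in> sigma_cong" "(t, w) \<in> sigma_cong"
    then obtain u v where S: "s \<in> S" "t \<in> S" "w \<in> S" and le: "nat_le u s" "nat_le v w"
      and uv: "nat_le u t" "nat_le v t"
      by (auto simp: sigma_cong_def)
    obtain e f where ef: "e \<in> idempotents" "f \<in> idempotents" and eq: "u = e \<cdot> t" "v = f \<cdot> t"
      using uv by (auto simp: nat_le_def)
    \<comment> \<open>The lower bounds \<open>u\<close> and \<open>v\<close> both lie below
      \<open>t\<close>. Since idempotents commute, multiplying \<open>t\<close> by both idempotents
      gives an element below \<open>u\<close> and \<open>v\<close>, hence below \<open>s\<close> and
      \<open>w\<close>.\<close>
    let ?u = "e \<cdot> f \<cdot> t"
    have "?u = e \<cdot> (f \<cdot> t)"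
      using ef S by (simp add: mult_assoc idempotents_closed)
    moreover have "?u = f \<cdot> (e \<cdot> t)"
      using ef S by (simp add: idempotents_commute[of e f] mult_assoc idempotents_closed)
    ultimately have "nat_le ?u (e \<cdot> t)" "nat_le ?u (f \<cdot> t)"
      using nat_leI[OF ef(2), of "e \<cdot> t"] nat_leI[OF ef(1), of "f \<cdot> t"] by simp_all
    then have "nat_le ?u s" "nat_le ?u w" using le S nat_le_trans unfolding eq by blast+
    moreover have "?u \<in> S" using ef S by (simp add: closed idempotents_closed)
    ultimately show "(s, w) \<in> sigma_cong" using S by (auto simp: sigma_cong_def)
  qed
qed

lemma sigma_eq_iff: "s \<in> S \<Longrightarrow> t \<in> S \<Longrightarrow> sigma s = sigma t \<longleftrightarrow> (s, t) \<in> sigma_cong"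
  unfolding sigma_def by (rule eq_equiv_class_iff[OF equiv_sigma_cong])

section \<open>Local sets and the maximum condition\<close>

lemma local_set_iff:
  assumes e: "e \<in> idempotents" and f: "f \<in> idempotents"
  shows "s \<in> local_set e f \<longleftrightarrow> s \<in> S \<and> e \<cdot> s = s \<and> s \<cdot> f = s"
proof
  assume "s \<in> local_set e f"
  then show "s \<in> S \<and> e \<cdot> s = s \<and> s \<cdot> f = s"
    using e f by (auto simp: local_set_def mult_assoc closed idempotents_closed
        idempotent_mult_self idempotent_mult_self_left)
next
  assume "s \<in> S \<and> e \<cdot> s = s \<and> s \<cdot> f = s"
  then show "s \<in> local_set e f" unfolding local_set_def by force
qed

text \<open>The idempotent \<open>h\<close> witnessing \<open>u \<le> s\<close> commutes with
  \<open>e\<close>. As a consequence, any common lower bound of two elements of a local set is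
  itself in that local set.\<close>

lemma local_set_down_closed:
  assumes ef: "e \<in> idempotents" "f \<in> idempotents"
    and s: "s \<in> local_set e f" and le: "nat_le u s"
  shows "u \<in> local_set e f"
proof -
  obtain h where h: "h \<in> idempotents" and u: "u = h \<cdot> s" using le by (auto simp: nat_le_def)
  note [simp] = closed idempotents_closed[OF ef(1)] idempotents_closed[OF ef(2)] idempotents_closed[OF h]
  have s': "s \<in> S" "e \<cdot> s = s" "s \<cdot> f = s" using s ef by (simp_all add: local_set_iff)
  have "e \<cdot> u = (e \<cdot> h) \<cdot> s" using s' by (simp add: u mult_assoc)
  also have "\<dots> = u" using s' by (simp add: idempotents_commute[OF ef(1) h] mult_assoc u)
  finally show ?thesis using s' ef by (simp add: local_set_iff u mult_assoc)
qed

text \<open>The right factor \<open>f\<close> moves to the left of \<open>s\<close> as the conjugate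
  \<open>s \<cdot> f \<cdot> star s\<close>, so the compressed element lies below \<open>s\<close>.
  Hence every class meets every local set.\<close>

lemma sigma_cong_local:
  assumes s: "s \<in> S" and e: "e \<in> idempotents" and f: "f \<in> idempotents"
  shows "(e \<cdot> s \<cdot> f, s) \<in> sigma_cong"
proof -
  note [simp] = closed idempotents_closed[OF e] idempotents_closed[OF f] s
  have "e \<cdot> s \<cdot> f = (e \<cdot> (s \<cdot> f \<cdot> star s)) \<cdot> s"
    using conj_idempotent(2)[OF s f] by (simp add: mult_assoc)
  then have "nat_le (e \<cdot> s \<cdot> f) s"
    using nat_leI[OF idempotents_mult_closed[OF e conj_idempotent(1)[OF s f]], of s] by simp
  then show ?thesis using nat_le_refl[of "e \<cdot> s \<cdot> f"] by (auto simp: sigma_cong_def)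
qed

text \<open>This form avoids the quotient: a class is named by a representative \<open>t\<close>
  inside the local set, which is what the maps between local sets can transport.\<close>

lemma F_inverse_iff:
  "F_inverse \<longleftrightarrow> (\<forall>e \<in> idempotents. \<forall>f \<in> idempotents. \<forall>t \<in> local_set e f.
    \<exists>m \<in> local_set e f. (m, t) \<in> sigma_cong \<and>
      (\<forall>s \<in> local_set e f. (s, t) \<in> sigma_cong \<longrightarrow> nat_le s m))"
    (is "_ = ?R")
proof
  assume F: F_inverse
  show ?R
  proof (intro ballI)
    fix e f t assume ef: "e \<in> idempotents" "f \<in> idempotents" and t: "t \<in> local_set e f"
    have loc: "s \<in> S" if "s \<in> local_set e f" for s using that ef by (simp add: local_set_iff)
    have "sigma t \<in> max_group_image"
      using loc[OF t] by (auto simp: sigma_def max_group_image_def quotient_def)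
    then obtain m where "m \<in> {s \<in> S. sigma s = sigma t} \<inter> local_set e f"
      "\<forall>s \<in> {s \<in> S. sigma s = sigma t} \<inter> local_set e f. nat_le s m"
      using F ef unfolding F_inverse_def by blast
    then show "\<exists>m \<in> local_set e f. (m, t) \<in> sigma_cong \<and>
      (\<forall>s \<in> local_set e f. (s, t) \<in> sigma_cong \<longrightarrow> nat_le s m)"
      using loc t sigma_eq_iff by (intro bexI[of _ m]) auto
  qed
next
  assume R: ?R
  show F_inverse unfolding F_inverse_def
  proof (intro ballI)
    fix g e f
    assume g: "g \<in> max_group_image" and ef: "e \<in> idempotents" "f \<in> idempotents"
    have loc: "s \<in> S" if "s \<in> local_set e f" for s using that ef by (simp add: local_set_iff)
    obtain u where u: "u \<in> S" "g = sigma u"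
      using g by (auto simp: max_group_image_def quotient_def sigma_def)
    \<comment> \<open>The representative \<open>u\<close> may lie outside the local set; compressing
      it by \<open>e\<close> and \<open>f\<close> brings it inside without changing its
      class.\<close>
    let ?t = "e \<cdot> u \<cdot> f"
    have t: "?t \<in> local_set e f" using u by (auto simp: local_set_def)
    have g: "g = sigma ?t" using u sigma_cong_local[OF u(1) ef] loc[OF t] sigma_eq_iff by metis
    obtain m where "m \<in> local_set e f" "(m, ?t) \<in> sigma_cong"
      "\<forall>s \<in> local_set e f. (s, ?t) \<in> sigma_cong \<longrightarrow> nat_le s m"
      using R ef t by blast
    then show "\<exists>m \<in> {s \<in> S. sigma s = g} \<inter> local_set e f.
        \<forall>s \<in> {s \<in> S. sigma s = g} \<inter> local_set e f. nat_le s m"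
      using loc t sigma_eq_iff g by (intro bexI[of _ m]) auto
  qed
qed

end

section \<open>Morita contexts\<close>

context Morita_context
begin

section \<open>Calculus of the pairings and the dual context\<close>

lemma ipS_closed: "x \<in> X \<Longrightarrow> y \<in> X \<Longrightarrow> ipS x y \<in> S"
  using ipS_surj by force

lemma ipT_closed: "x \<in> X \<Longrightarrow> y \<in> X \<Longrightarrow> ipT x y \<in> T"
  using ipT_surj by force

lemmas context_closed = ipS_closed ipT_closed lact_closed ract_closed S.closed T.closed

lemma ipS_lact_right:
  assumes "s \<in> S" "x \<in> X" "y \<in> X"
  shows "ipS x (s \<rhd> y) = ipS x y \<cdot>\<^sub>S S.star s"
  using assms ipS_star[of "s \<rhd> y" x] ipS_star[of y x]
  by (simp add: context_closed ipS_lact S.star_mult)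

lemma ipT_ract_left:
  assumes "t \<in> T" "x \<in> X" "y \<in> X"
  shows "ipT (x \<lhd> t) y = T.star t \<cdot>\<^sub>T ipT x y"
  using assms ipT_star[of y "x \<lhd> t"] ipT_star[of y x]
  by (simp add: context_closed ipT_ract T.star_mult)

text \<open>Composing an action with the involution reverses the order of composition, so left and
  right actions trade places. Each fact about \<open>ipT\<close> then has a mirror image for
  \<open>ipS\<close>.\<close>

lemma dual: "Morita_context T (\<cdot>\<^sub>T) S (\<cdot>\<^sub>S) X (\<lambda>t x. x \<lhd> T.star t) (\<lambda>x s. S.star s \<rhd> x) ipT ipS"
proof unfold_locales
  \<comment> \<open>Compatibility in the dual is the original law read backwards:
    \<open>z \<lhd> ipT y x = ipS z y \<rhd> x\<close>.\<close>
  fix x y z assume "x \<in> X" "y \<in> X" "z \<in> X"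
  then show "z \<lhd> T.star (ipT x y) = S.star (ipS y z) \<rhd> x"
    by (simp add: ip_compat flip: ipS_star ipT_star)
qed (use ipS_surj ipT_surj in \<open>auto simp: context_closed S.star_mult T.star_mult S.star_star T.star_star
    lact_assoc ract_assoc act_commute ipS_lact_right ipT_ract_left ipS_self ipT_self
    simp flip: ipS_star ipT_star\<close>)

text \<open>By surjectivity \<open>s = ipS a b\<close>, and compatibility turns the action of
  \<open>s\<close> into a right action by values of \<open>ipT\<close>, which the pairing rules move
  across.\<close>

lemma ipT_adjoint:
  assumes s: "s \<in> S" and x: "x \<in> X" and y: "y \<in> X"
  shows "ipT (s \<rhd> x) y = ipT x (S.star s \<rhd> y)"
proof -
  obtain a b where ab: "a \<in> X" "b \<in> X" and s_eq: "s = ipS a b" using ipS_surj s by force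
  have "ipT (s \<rhd> x) y = T.star (ipT b x) \<cdot>\<^sub>T ipT a y"
    using ab x y by (simp add: s_eq ip_compat ipT_ract_left context_closed)
  also have "\<dots> = ipT x (b \<lhd> ipT a y)"
    using ab x y by (simp add: ipT_ract context_closed flip: ipT_star)
  also have "\<dots> = ipT x (S.star s \<rhd> y)"
    using ab y by (simp add: s_eq flip: ip_compat ipS_star)
  finally show ?thesis .
qed

section \<open>Idempotents as self-pairings\<close>

lemma ipS_self_idempotent: "x \<in> X \<Longrightarrow> ipS x x \<in> S.idempotents"
  using ipS_lact[of "ipS x x" x x] by (simp add: S.idempotents_def ipS_closed ipS_self)

lemma ipT_self_idempotent: "x \<in> X \<Longrightarrow> ipT x x \<in> T.idempotents"
  using ipT_ract[of x x "ipT x x"] by (simp add: T.idempotents_def ipT_closed ipT_self)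

text \<open>Write \<open>p\<close> as \<open>p \<cdot>\<^sub>S p\<close> and move one factor to the
  first argument, where it reappears as \<open>star p = p\<close>.\<close>

lemma ipT_idempotent_lact:
  assumes p: "p \<in> S.idempotents" and x: "x \<in> X"
  shows "ipT x (p \<rhd> x) = ipT (p \<rhd> x) (p \<rhd> x)"
  using S.idempotents_closed[OF p] x S.idempotent_mult_self[OF p]
  by (simp add: ipT_adjoint S.star_idempotent[OF p] context_closed flip: lact_assoc)

text \<open>Surjectivity only gives \<open>e = ipT x y\<close>. Expanding
  \<open>e \<cdot>\<^sub>T star e\<close> replaces \<open>y\<close> by
  \<open>ipS y y \<rhd> x\<close>, and the idempotent \<open>ipS y y\<close> can be shared between
  both arguments.\<close>

lemma idempotentT_obtain:
  assumes e: "e \<in> T.idempotents"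
  obtains x where "x \<in> X" "e = ipT x x"
proof -
  obtain x y where xy: "x \<in> X" "y \<in> X" and e_eq: "e = ipT x y"
    using T.idempotents_closed[OF e] ipT_surj by force
  have "e = e \<cdot>\<^sub>T T.star e" by (simp add: e T.star_idempotent T.idempotent_mult_self)
  also have "\<dots> = ipT x (y \<lhd> ipT y x)"
    using xy by (simp add: e_eq ipT_ract context_closed flip: ipT_star)
  also have "\<dots> = ipT (ipS y y \<rhd> x) (ipS y y \<rhd> x)"
    using xy ipT_idempotent_lact[OF ipS_self_idempotent] by (simp flip: ip_compat)
  finally show ?thesis using that xy by (blast intro: context_closed)
qed

section \<open>Order isomorphism between local sets\<close>

lemma ipT_lact_local:
  assumes "x \<in> X" "y \<in> X" "s \<in> S"
  shows "ipT x (s \<rhd> y) \<in> T.local_set (ipT x x) (ipT y y)"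
proof -
  have "ipT x x \<cdot>\<^sub>T ipT x (s \<rhd> y) = ipT (x \<lhd> ipT x x) (s \<rhd> y)"
    using assms by (simp add: ipT_ract_left context_closed flip: ipT_star)
  moreover have "ipT x (s \<rhd> y) \<cdot>\<^sub>T ipT y y = ipT x (s \<rhd> (y \<lhd> ipT y y))"
    using assms by (simp add: context_closed flip: ipT_ract act_commute)
  ultimately show ?thesis
    using assms by (simp add: T.local_set_iff ipT_self_idempotent ipT_self context_closed)
qed

lemma ipT_lact_mono:
  assumes x: "x \<in> X" and y: "y \<in> X" and s': "s' \<in> S" "ipS x x \<cdot>\<^sub>S s' = s'"
    and le: "S.nat_le s s'"
  shows "T.nat_le (ipT x (s \<rhd> y)) (ipT x (s' \<rhd> y))"
proof -
  obtain q where q: "q \<in> S.idempotents" and s: "s = q \<cdot>\<^sub>S s'" using le by (auto simp: S.nat_le_def)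
  note [simp] = context_closed S.idempotents_closed[OF q] x y s'(1)
  \<comment> \<open>Inserting \<open>ipS x x\<close> in front of \<open>s'\<close> lets
    \<open>q\<close> be absorbed into a pairing; compatibility then converts \<open>q\<close> into
    the idempotent \<open>ipT x (q \<rhd> x)\<close> of \<open>T\<close>.\<close>
  have "s \<rhd> y = (ipS (q \<rhd> x) x \<cdot>\<^sub>S s') \<rhd> y"
    by (simp add: s ipS_lact S.mult_assoc s'(2))
  also have "\<dots> = (q \<rhd> x) \<lhd> ipT x (s' \<rhd> y)"
    by (simp add: lact_assoc ip_compat)
  finally have "ipT x (s \<rhd> y) = ipT x (q \<rhd> x) \<cdot>\<^sub>T ipT x (s' \<rhd> y)"
    by (simp add: ipT_ract)
  then show ?thesis
    using T.nat_leI[OF ipT_self_idempotent[of "q \<rhd> x"]] by (simp add: ipT_idempotent_lact[OF q])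
qed

lemma ipS_adjoint:
  assumes "t \<in> T" "x \<in> X" "y \<in> X"
  shows "ipS (x \<lhd> t) y = ipS x (y \<lhd> T.star t)"
proof -
  interpret D: Morita_context T "(\<cdot>\<^sub>T)" S "(\<cdot>\<^sub>S)" X "\<lambda>t x. x \<lhd> T.star t" "\<lambda>x s. S.star s \<rhd> x" ipT ipS
    by (rule dual)
  show ?thesis using D.ipT_adjoint[of "T.star t" x y] assms by (simp add: T.star_star context_closed)
qed

text \<open>By adjointness the inner pairing is \<open>ipS (x \<lhd> t) y\<close>; acting on
  \<open>y\<close> and pairing with \<open>x\<close> yields
  \<open>ipT x x \<cdot>\<^sub>T t \<cdot>\<^sub>T ipT y y\<close>, which is \<open>t\<close> on the
  local set.\<close>

lemma ipT_ipS_inverse: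
  assumes x: "x \<in> X" and y: "y \<in> X" and t: "t \<in> T.local_set (ipT x x) (ipT y y)"
  shows "ipT x (ipS x (y \<lhd> T.star t) \<rhd> y) = t"
  using assms
  by (simp add: T.local_set_iff ipT_self_idempotent ip_compat ipT_ract context_closed T.mult_assoc
      flip: ipS_adjoint)

lemma F_inverse_transfer:
  assumes F: "S.F_inverse"
  shows "T.F_inverse"
  unfolding T.F_inverse_iff
proof (intro ballI)
  interpret D: Morita_context T "(\<cdot>\<^sub>T)" S "(\<cdot>\<^sub>S)" X "\<lambda>t x. x \<lhd> T.star t" "\<lambda>x s. S.star s \<rhd> x" ipT ipS
    by (rule dual)
  fix e f t
  assume e: "e \<in> T.idempotents" and f: "f \<in> T.idempotents" and t: "t \<in> T.local_set e f"
  obtain x where x: "x \<in> X" "e = ipT x x" using idempotentT_obtain[OF e] .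
  obtain y where y: "y \<in> X" "f = ipT y y" using idempotentT_obtain[OF f] .
  let ?p = "ipS x x" and ?q = "ipS y y"
  \<comment> \<open>In this form, equal to \<open>ipS (x \<lhd> t) y\<close> by adjointness, \<Phi>
    is the dual-context counterpart of \<Psi>, so locality and monotonicity come from the lemmas for
    \<open>D\<close>.\<close>
  define \<Phi> where "\<Phi> t = ipS x (y \<lhd> T.star t)" for t
  define \<Psi> where "\<Psi> s = ipT x (s \<rhd> y)" for s
  have p: "?p \<in> S.idempotents" and q: "?q \<in> S.idempotents"
    using x y ipS_self_idempotent by auto
  note locT = T.local_set_iff[OF e f] and locS = S.local_set_iff[OF p q]
  have \<Phi>_loc: "\<Phi> u \<in> S.local_set ?p ?q" if "u \<in> T.local_set e f" for u
    using that D.ipT_lact_local[OF x(1) y(1)] by (simp add: \<Phi>_def locT)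
  have \<Psi>_loc: "\<Psi> s \<in> T.local_set e f" if "s \<in> S.local_set ?p ?q" for s
    using that x y ipT_lact_local by (simp add: \<Psi>_def locS)
  have \<Psi>\<Phi>: "\<Psi> (\<Phi> u) = u" if "u \<in> T.local_set e f" for u
    using that x y ipT_ipS_inverse by (simp add: \<Psi>_def \<Phi>_def)
  have \<Phi>_mono: "S.nat_le (\<Phi> u) (\<Phi> v)" if "T.nat_le u v" "v \<in> T.local_set e f" for u v
    using that D.ipT_lact_mono[OF x(1) y(1)] by (simp add: \<Phi>_def locT flip: x(2))
  have \<Psi>_mono: "T.nat_le (\<Psi> r) (\<Psi> s)" if "S.nat_le r s" "s \<in> S.local_set ?p ?q" for r s
    using that ipT_lact_mono[OF x(1) y(1)] by (simp add: \<Psi>_def locS)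
  have \<Phi>_cong: "(\<Phi> u, \<Phi> v) \<in> S.sigma_cong"
    if uv: "(u, v) \<in> T.sigma_cong" "u \<in> T.local_set e f" "v \<in> T.local_set e f" for u v
  proof -
    obtain w where w: "T.nat_le w u" "T.nat_le w v" using uv by (auto simp: T.sigma_cong_def)
    \<comment> \<open>Downward closure puts the lower bound \<open>w\<close> where monotonicity of
      \<Phi> yields a lower bound in a local set of \<open>S\<close>.\<close>
    have "w \<in> T.local_set e f" using T.local_set_down_closed[OF e f uv(2) w(1)] .
    then show ?thesis
      using \<Phi>_mono[OF w(1)] \<Phi>_mono[OF w(2)] \<Phi>_loc uv by (auto simp: S.sigma_cong_def locS)
  qed
  have \<Psi>_cong: "(\<Psi> r, \<Psi> s) \<in> T.sigma_cong"
    if rs: "(r, s) \<in> S.sigma_cong" "r \<in> S.local_set ?p ?q" "s \<in> S.local_set ?p ?q" for r s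
  proof -
    obtain w where w: "S.nat_le w r" "S.nat_le w s" using rs by (auto simp: S.sigma_cong_def)
    have "w \<in> S.local_set ?p ?q" using S.local_set_down_closed[OF p q rs(2) w(1)] .
    then show ?thesis
      using \<Psi>_mono[OF w(1)] \<Psi>_mono[OF w(2)] \<Psi>_loc rs by (auto simp: T.sigma_cong_def locT)
  qed
  obtain m where m: "m \<in> S.local_set ?p ?q" "(m, \<Phi> t) \<in> S.sigma_cong"
    and max: "\<And>s. s \<in> S.local_set ?p ?q \<Longrightarrow> (s, \<Phi> t) \<in> S.sigma_cong \<Longrightarrow> S.nat_le s m"
    using F p q \<Phi>_loc[OF t] unfolding S.F_inverse_iff by blast
  have "(\<Psi> m, t) \<in> T.sigma_cong" using \<Psi>_cong[OF m(2,1) \<Phi>_loc[OF t]] \<Psi>\<Phi>[OF t] by simp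
  \<comment> \<open>Maximality gives \<open>\<Phi> u \<le> m\<close>; applying \<Psi> and
    \<open>\<Psi> (\<Phi> u) = u\<close> brings this back to \<open>T\<close>.\<close>
  moreover have "T.nat_le u (\<Psi> m)" if "u \<in> T.local_set e f" "(u, t) \<in> T.sigma_cong" for u
    using \<Psi>_mono[OF max[OF \<Phi>_loc \<Phi>_cong] m(1)] \<Psi>\<Phi> that t by simp
  ultimately show "\<exists>m \<in> T.local_set e f. (m, t) \<in> T.sigma_cong \<and>
      (\<forall>s \<in> T.local_set e f. (s, t) \<in> T.sigma_cong \<longrightarrow> T.nat_le s m)"
    using \<Psi>_loc[OF m(1)] by blast
qed

end

theorem proposition5p11:
  fixes S :: "'a set" and multS :: "'a \<Rightarrow> 'a \<Rightarrow> 'a"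
    and T :: "'b set" and multT :: "'b \<Rightarrow> 'b \<Rightarrow> 'b"
  assumes "inverse_semigroup S multS"
    and "inverse_semigroup T multT"
    and "strongly_Morita_equivalent TYPE('x) S multS T multT"
  shows "inverse_semigroup.F_inverse S multS \<longleftrightarrow> inverse_semigroup.F_inverse T multT"
proof -
  obtain X :: "'x set" and lact ract ipS ipT
    where "Morita_context S multS T multT X lact ract ipS ipT"
    using assms(3) unfolding strongly_Morita_equivalent_def by blast
  then show ?thesis
    using Morita_context.F_inverse_transfer Morita_context.F_inverse_transfer[OF Morita_context.dual]
    by blast
qed

end
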